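(* For every sufficiently large integer $n$ with $n \equiv 0 \pmod 3$, there exists an order-$n$ Latin square with at most \[ \left(\frac{n}{e^{2.117}}\right)^n \] transversals.
   Context: An order-$n$ Latin square is an $n\times n$ array filled with $n$ symbols such that each row and each column contains each symbol exactly once. A transversal of an order-$n$ Latin square is a collection of $n$ cells, no two of which share a row, a column, or a symbol. *)

theory Defs
  imports Complex_Main
begin

text \<open>
  Rows, columns and symbols of an order-\<open>n\<close> Latin square are all indexed by \<open>{..<n}\<close>;
  values of \<open>L\<close> outside \<open>{..<n} \<times> {..<n}\<close> are irrelevant.
\<close>

definition latin_square :: "nat \<Rightarrow> (nat \<Rightarrow> nat \<Rightarrow> nat) \<Rightarrow> bool" where
  "latin_square n L \<longleftrightarrow>
     (\<forall>i<n. \<forall>j<n. L i j < n) \<and>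
     (\<forall>i<n. \<forall>s<n. \<exists>!j. j < n \<and> L i j = s) \<and>
     (\<forall>j<n. \<forall>s<n. \<exists>!i. i < n \<and> L i j = s)"

definition transversal :: "nat \<Rightarrow> (nat \<Rightarrow> nat \<Rightarrow> nat) \<Rightarrow> (nat \<times> nat) set \<Rightarrow> bool" where
  "transversal n L T \<longleftrightarrow>
     T \<subseteq> {..<n} \<times> {..<n} \<and> card T = n \<and>
     (\<forall>c\<in>T. \<forall>d\<in>T. c \<noteq> d \<longrightarrow>
        fst c \<noteq> fst d \<and> snd c \<noteq> snd d \<and> L (fst c) (snd c) \<noteq> L (fst d) (snd d))"

lemma finite_transversals: "finite {T. transversal n L T}"
  by (rule finite_subset[of _ "Pow ({..<n} \<times> {..<n})"]) (auto simp: transversal_def)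

end

theory Submission
  imports Defs "HOL-Library.FuncSet" "HOL-Number_Theory.Cong"
begin

text \<open>
  Let \<open>n = 3m\<close> and take the Cayley table of \<open>\<int>/3 \<times> \<int>/m\<close>. If \<open>m\<close> is even, summing the
  \<open>\<int>/m\<close>-coordinates of rows, columns and symbols shows that it has no transversal. If \<open>m\<close> is
  odd, replace every symbol of the \<open>m \<times> m\<close> subsquare over \<open>(0, 0)\<close> by its translate by
  \<open>(0, 1)\<close>. The same summation then shows that the number of cells of a transversal in this
  subsquare is divisible by \<open>m\<close>, hence \<open>0\<close> or \<open>m\<close>, and counting cells by their
  \<open>\<int>/3\<close>-coordinates leaves only transversals all of whose cells avoid the diagonal blocks
  \<open>(i, i)\<close>, or all of whose cells lie in them. Either way each row has at most \<open>2m\<close>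
  usable cells.

  Transversals with at most \<open>d\<close> usable cells per row are counted by revealing the rows in random
  order, as in the entropy proof of Bregman's theorem: when a fraction \<open>p\<close> of the rows is still
  hidden, a usable cell of the current row survives only if the rows containing its column and its
  symbol in the transversal are hidden too, so about \<open>1 + d p\<^sup>2\<close> choices are expected. This gives
  about \<open>(d / e\<^sup>2)\<^sup>n = (2n / (3e\<^sup>2))\<^sup>n\<close> transversals, and \<open>2 + ln (3/2) > 2.4\<close>. The
  slack allows the random order to be replaced by independent labels from \<open>{1..24}\<close>, ties being
  broken pessimistically.
\<close>

section \<open>The entropy bound\<close>

text \<open>Rows are revealed in decreasing order of their labels \<open>\<tau>\<close>; these are the values at \<open>x\<close> that
  remain possible once \<open>f\<close> is known on the rows revealed strictly before \<open>x\<close>.\<close>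

definition choices ::
  "'r set \<Rightarrow> ('r \<Rightarrow> nat) \<Rightarrow> ('r \<Rightarrow> 'c) set \<Rightarrow> ('r \<Rightarrow> 'c) \<Rightarrow> 'r \<Rightarrow> 'c set" where
  "choices I \<tau> F f x = (\<lambda>g. g x) ` {g \<in> F. \<forall>y\<in>I. \<tau> x < \<tau> y \<longrightarrow> g y = f y}"

lemma finite_choices: "finite F \<Longrightarrow> finite (choices I \<tau> F f x)"
  by (simp add: choices_def)

lemma card_choices_pos: "finite F \<Longrightarrow> f \<in> F \<Longrightarrow> 0 < card (choices I \<tau> F f x)"
  by (auto simp: choices_def card_gt_0_iff)

text \<open>Kraft's inequality for the tree of successive choices.\<close>

lemma sum_inverse_prod_choices_le_1:
  fixes \<tau> :: "'r \<Rightarrow> nat" and F :: "('r \<Rightarrow> 'c) set"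
  assumes "finite F" and "distinct xs" and "sorted_wrt (\<lambda>x y. \<tau> y \<le> \<tau> x) xs"
    and "\<And>f g. f \<in> F \<Longrightarrow> g \<in> F \<Longrightarrow> (\<And>x. x \<in> set xs \<Longrightarrow> f x = g x) \<Longrightarrow> f = g"
  shows "(\<Sum>f\<in>F. \<Prod>x\<in>set xs. 1 / real (card (choices (set xs) \<tau> F f x))) \<le> 1"
  using assms
proof (induction xs arbitrary: F)
  case Nil
  have "card F \<le> 1"
    using Nil.prems(1,4) by (auto simp: card_le_Suc0_iff_eq)
  then show ?case by simp
next
  case (Cons x xs)
  define V where "V = (\<lambda>g. g x) ` F"
  define G where "G v = {g \<in> F. g x = v}" for v
  have fin: "finite (G v)" for v
    using Cons.prems(1) by (simp add: G_def)
  have IH: "(\<Sum>f\<in>G v. \<Prod>y\<in>set xs. 1 / real (card (choices (set xs) \<tau> (G v) f y))) \<le> 1" for v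
  proof (rule Cons.IH)
    fix f g assume "f \<in> G v" "g \<in> G v" and "\<And>y. y \<in> set xs \<Longrightarrow> f y = g y"
    then show "f = g"
      by (intro Cons.prems(4)) (auto simp: G_def)
  qed (use fin Cons.prems in auto)
  \<comment> \<open>The head \<open>x\<close> has a maximal label, so no row is revealed strictly
    before it and the agreement condition is vacuous.\<close>
  have first: "choices (set (x # xs)) \<tau> F f x = V" for f
    using Cons.prems(3) by (force simp: choices_def V_def)
  have step: "(\<Prod>y\<in>set (x # xs). 1 / real (card (choices (set (x # xs)) \<tau> F f y)))
      \<le> 1 / real (card V) * (\<Prod>y\<in>set xs. 1 / real (card (choices (set xs) \<tau> (G v) f y)))"
    if f: "f \<in> G v" for f v
  proof -
    \<comment> \<open>Members of \<open>G v\<close> already agree with \<open>f\<close> at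
      \<open>x\<close>, so deleting \<open>x\<close> only shrinks the choices; the inclusion can be
      strict when \<open>y\<close> ties with \<open>x\<close>.\<close>
    have "card (choices (set xs) \<tau> (G v) f y) \<le> card (choices (set (x # xs)) \<tau> F f y)" for y
      using f by (intro card_mono finite_choices Cons.prems(1)) (auto simp: choices_def G_def)
    then have "(\<Prod>y\<in>set xs. 1 / real (card (choices (set (x # xs)) \<tau> F f y)))
        \<le> (\<Prod>y\<in>set xs. 1 / real (card (choices (set xs) \<tau> (G v) f y)))"
      by (intro prod_mono conjI divide_left_mono mult_pos_pos)
        (use card_choices_pos[OF fin f] f Cons.prems(1) in \<open>auto simp: G_def card_choices_pos\<close>)
    moreover have "(\<Prod>y\<in>set (x # xs). 1 / real (card (choices (set (x # xs)) \<tau> F f y)))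
        = 1 / real (card V) * (\<Prod>y\<in>set xs. 1 / real (card (choices (set (x # xs)) \<tau> F f y)))"
      unfolding first[of f, symmetric]
      using Cons.prems(2) by (subst list.set(2), subst prod.insert) auto
    ultimately show ?thesis
      by (metis mult_left_mono zero_le_divide_1_iff of_nat_0_le_iff)
  qed
  have "(\<Sum>f\<in>F. \<Prod>y\<in>set (x # xs). 1 / real (card (choices (set (x # xs)) \<tau> F f y)))
      = (\<Sum>v\<in>V. \<Sum>f\<in>G v. \<Prod>y\<in>set (x # xs). 1 / real (card (choices (set (x # xs)) \<tau> F f y)))"
    unfolding V_def G_def by (rule sum.image_gen[OF Cons.prems(1)])
  also have "\<dots> \<le> (\<Sum>v\<in>V. \<Sum>f\<in>G v. 1 / real (card V) *
      (\<Prod>y\<in>set xs. 1 / real (card (choices (set xs) \<tau> (G v) f y))))"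
    by (intro sum_mono step)
  also have "\<dots> \<le> (\<Sum>v\<in>V. 1 / real (card V))"
  proof (rule sum_mono)
    fix v
    show "(\<Sum>f\<in>G v. 1 / real (card V) *
        (\<Prod>y\<in>set xs. 1 / real (card (choices (set xs) \<tau> (G v) f y)))) \<le> 1 / real (card V)"
      unfolding sum_distrib_left[symmetric]
      by (rule mult_left_le[OF IH]) simp
  qed
  also have "\<dots> \<le> 1" by simp
  finally show ?case .
qed

text \<open>Kraft's inequality gives weights \<open>P f\<close> of total at most 1. Summing
  \<open>ln t \<le> t - 1\<close> at \<open>t = card F * P f\<close> then plays the part of the
  chain rule for entropy.\<close>

lemma card_mult_ln_card_le:
  fixes \<tau> :: "'r \<Rightarrow> nat" and F :: "('r \<Rightarrow> 'c) set"
  assumes "finite I" and "finite F" and "F \<subseteq> extensional I"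
  shows "card F * ln (card F) \<le> (\<Sum>f\<in>F. \<Sum>x\<in>I. ln (card (choices I \<tau> F f x)))"
proof (cases "F = {}")
  case False
  obtain ys where ys: "set ys = I" "distinct ys"
    using finite_distinct_list[OF assms(1)] by blast
  define xs where "xs = rev (sort_key \<tau> ys)"
  have xs: "set xs = I" "distinct xs"
    using ys by (simp_all add: xs_def)
  have "sorted_wrt (\<lambda>x y. \<tau> x \<le> \<tau> y) (sort_key \<tau> ys)"
    using sorted_sort_key[of \<tau> ys] by (simp add: sorted_map)
  then have "sorted_wrt (\<lambda>x y. \<tau> y \<le> \<tau> x) xs"
    by (simp add: xs_def sorted_wrt_rev)
  moreover have "f = g" if "f \<in> F" "g \<in> F" "\<And>x. x \<in> set xs \<Longrightarrow> f x = g x" for f g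
    using that assms(3) xs(1) by (intro extensionalityI[of f I g]) auto
  ultimately have kraft: "(\<Sum>f\<in>F. \<Prod>x\<in>I. 1 / real (card (choices I \<tau> F f x))) \<le> 1"
    using sum_inverse_prod_choices_le_1[OF assms(2) xs(2)] unfolding xs(1) by blast
  define P where "P f = (\<Prod>x\<in>I. 1 / real (card (choices I \<tau> F f x)))" for f
  have cF: "0 < card F" using False assms(2) by (simp add: card_gt_0_iff)
  have pos: "0 < card (choices I \<tau> F f x)" if "f \<in> F" for f x
    using card_choices_pos[OF assms(2) that] .
  have ln_P: "ln (card F * P f) = ln (card F) - (\<Sum>x\<in>I. ln (card (choices I \<tau> F f x)))"
    if f: "f \<in> F" for f
  proof -
    have "0 < P f" unfolding P_def by (intro prod_pos) (simp add: pos f)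
    moreover have "ln (P f) = (\<Sum>x\<in>I. - ln (card (choices I \<tau> F f x)))"
      unfolding P_def using pos[OF f] assms(1) by (subst ln_prod) (auto simp: ln_div)
    ultimately show ?thesis using cF by (simp add: ln_mult sum_negf)
  qed
  have "(\<Sum>f\<in>F. ln (card F) - (\<Sum>x\<in>I. ln (card (choices I \<tau> F f x))))
      \<le> (\<Sum>f\<in>F. card F * P f - 1)"
  proof (rule sum_mono)
    fix f assume f: "f \<in> F"
    have "0 < P f" unfolding P_def by (intro prod_pos) (simp add: pos f)
    then show "ln (card F) - (\<Sum>x\<in>I. ln (card (choices I \<tau> F f x))) \<le> card F * P f - 1"
      unfolding ln_P[OF f, symmetric] using cF by (intro ln_le_minus_one) simp
  qed
  also have "\<dots> = card F * ((\<Sum>f\<in>F. P f) - 1)"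
    by (simp add: sum_subtractf sum_distrib_left right_diff_distrib)
  also have "\<dots> \<le> 0"
    using kraft by (simp add: P_def mult_le_0_iff)
  finally show ?thesis by (simp add: sum_subtractf)
qed simp

section \<open>Averaging over independent uniform labels\<close>

lemma card_labellings_fixed:
  assumes "finite I" and "i \<in> I" and "s \<in> {1..M}"
  shows "M * card {\<tau> \<in> I \<rightarrow>\<^sub>E {1..M}. \<tau> i = s} = M ^ card I"
proof -
  have "{\<tau> \<in> I \<rightarrow>\<^sub>E {1..M}. \<tau> i = s} = PiE I (\<lambda>j. if j = i then {s} else {1..M})"
    using assms by (auto simp: PiE_iff extensional_def split: if_splits)
  moreover have "(\<Prod>j\<in>I - {i}. card (if j = i then {s} else {1..M})) = M ^ card (I - {i})"
    by (subst prod.cong[OF refl, of _ _ "\<lambda>_. M"]) auto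
  moreover have "M * M ^ card (I - {i}) = M ^ card I"
    using card_Suc_Diff1[OF assms(1,2)] by (metis power_Suc)
  ultimately show ?thesis
    using assms by (simp add: card_PiE prod.remove[of I i])
qed

text \<open>Labels of distinct rows are independent, so the event has probability
  \<open>s\<^sup>2 / M ^ 3\<close>. The non-strict comparisons count ties as still hidden.\<close>

lemma card_labellings_fixed_le_le:
  assumes "finite I" and "i \<in> I" "a \<in> I" "b \<in> I" "distinct [i, a, b]" and "s \<in> {1..M}"
  shows "M ^ 3 * card {\<tau> \<in> I \<rightarrow>\<^sub>E {1..M}. \<tau> i = s \<and> \<tau> a \<le> s \<and> \<tau> b \<le> s} = s\<^sup>2 * M ^ card I"
proof -
  define S where "S j = (if j = i then {s} else if j = a \<or> j = b then {1..s} else {1..M})" for j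
  have eq: "{\<tau> \<in> I \<rightarrow>\<^sub>E {1..M}. \<tau> i = s \<and> \<tau> a \<le> s \<and> \<tau> b \<le> s} = PiE I S"
  proof (intro equalityI subsetI)
    fix \<tau> assume t: "\<tau> \<in> PiE I S"
    then have "\<tau> i \<in> S i" "\<tau> a \<in> S a" "\<tau> b \<in> S b" using assms by auto
    moreover have "S j \<subseteq> {1..M}" for j using assms by (auto simp: S_def)
    then have "\<tau> \<in> I \<rightarrow>\<^sub>E {1..M}" using t PiE_mono[of I S "\<lambda>_. {1..M}"] by blast
    ultimately show "\<tau> \<in> {\<tau> \<in> I \<rightarrow>\<^sub>E {1..M}. \<tau> i = s \<and> \<tau> a \<le> s \<and> \<tau> b \<le> s}"
      using assms(5) by (auto simp: S_def)
  qed (auto simp: S_def PiE_iff)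
  define J where "J = I - {i, a, b}"
  have I: "I = insert i (insert a (insert b J))" and J: "finite J" "i \<notin> J" "a \<notin> J" "b \<notin> J"
    using assms by (auto simp: J_def)
  have "(\<Prod>j\<in>J. card (S j)) = M ^ card J"
    by (subst prod.cong[OF refl, of _ _ "\<lambda>_. M"]) (use J in \<open>auto simp: S_def\<close>)
  moreover have "card (S i) = 1" "card (S a) = s" "card (S b) = s"
    using assms(5) by (auto simp: S_def)
  moreover have "finite I" by fact
  ultimately have "card (PiE I S) = s\<^sup>2 * M ^ card J"
    using J assms(5) by (subst card_PiE) (auto simp: I power2_eq_square)
  moreover have "card I = card J + 3"
    using J assms(5) by (auto simp: I)
  ultimately show ?thesis unfolding eq by (simp add: power_add)
qed

text \<open>Here \<open>c\<^sub>0\<close> is the true value at \<open>i\<close>, always a candidate,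
  and \<open>a c\<close>, \<open>b c\<close> are the rows whose revealing excludes another value
  \<open>c\<close>. Given \<open>\<tau> i = s\<close>, such a \<open>c\<close> survives with
  probability \<open>(s / M)\<^sup>2\<close>, which bounds the mean of \<open>N\<close>; concavity
  of \<open>ln\<close> does the rest.\<close>

lemma sum_ln_labellings_le:
  fixes N :: "('r \<Rightarrow> nat) \<Rightarrow> nat" and a b :: "'c \<Rightarrow> 'r" and M d :: nat
  assumes I: "finite I" "i \<in> I" and A: "finite A" "card A \<le> d" and M: "0 < M"
    and ab: "\<And>c. c \<in> A - {c\<^sub>0} \<Longrightarrow> a c \<in> I \<and> b c \<in> I \<and> distinct [i, a c, b c]"
    and N_pos: "\<And>\<tau>. 0 < N \<tau>"
    and N_le: "\<And>\<tau>. \<tau> \<in> I \<rightarrow>\<^sub>E {1..M} \<Longrightarrow>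
      N \<tau> \<le> card ({c\<^sub>0} \<union> {c \<in> A - {c\<^sub>0}. \<tau> (a c) \<le> \<tau> i \<and> \<tau> (b c) \<le> \<tau> i})"
  shows "M * (\<Sum>\<tau>\<in>I \<rightarrow>\<^sub>E {1..M}. ln (N \<tau>))
    \<le> M ^ card I * (\<Sum>s=1..M. ln (1 + d * (real s / M)\<^sup>2))"
proof -
  define E where "E = I \<rightarrow>\<^sub>E {1..M}"
  have finE: "finite E" using I by (simp add: E_def finite_PiE)
  have main: "M * (\<Sum>\<tau>\<in>{\<tau>\<in>E. \<tau> i = s}. ln (N \<tau>)) \<le> M ^ card I * ln (1 + d * (s / M)\<^sup>2)"
    if s: "s \<in> {1..M}" for s
  proof -
    define Es where "Es = {\<tau>\<in>E. \<tau> i = s}"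
    \<comment> \<open>An upper bound for the mean of \<open>N\<close> over \<open>Es\<close>,
      established below in scaled form as \<open>sumN\<close>.\<close>
    define q where "q = 1 + d * (s / M)\<^sup>2"
    have q: "1 \<le> q" by (simp add: q_def)
    have finEs: "finite Es" using finE by (simp add: Es_def)
    have cardEs: "M * card Es = M ^ card I"
      unfolding Es_def E_def by (rule card_labellings_fixed[OF I s])
    have "(\<Sum>\<tau>\<in>Es. N \<tau>) \<le> (\<Sum>\<tau>\<in>Es. 1 + (\<Sum>c\<in>A - {c\<^sub>0}. of_bool (\<tau> (a c) \<le> s \<and> \<tau> (b c) \<le> s)))"
    proof (rule sum_mono)
      fix \<tau> assume t: "\<tau> \<in> Es"
      have "N \<tau> \<le> card ({c\<^sub>0} \<union> {c \<in> A - {c\<^sub>0}. \<tau> (a c) \<le> s \<and> \<tau> (b c) \<le> s})"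
        using N_le[of \<tau>] t by (simp add: Es_def E_def)
      also have "\<dots> \<le> 1 + card {c \<in> A - {c\<^sub>0}. \<tau> (a c) \<le> s \<and> \<tau> (b c) \<le> s}"
        using card_Un_le[of "{c\<^sub>0}"] by simp
      also have "card {c \<in> A - {c\<^sub>0}. \<tau> (a c) \<le> s \<and> \<tau> (b c) \<le> s}
          = (\<Sum>c\<in>A - {c\<^sub>0}. of_bool (\<tau> (a c) \<le> s \<and> \<tau> (b c) \<le> s))"
        using A by (simp add: sum_of_bool_eq Int_def)
      finally show "N \<tau> \<le> 1 + (\<Sum>c\<in>A - {c\<^sub>0}. of_bool (\<tau> (a c) \<le> s \<and> \<tau> (b c) \<le> s))" .
    qed
    also have "\<dots> = card Es + (\<Sum>c\<in>A - {c\<^sub>0}. \<Sum>\<tau>\<in>Es. of_bool (\<tau> (a c) \<le> s \<and> \<tau> (b c) \<le> s))"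
      by (subst sum.swap) (simp add: sum.distrib sum_Suc)
    also have "\<dots> = card Es + (\<Sum>c\<in>A - {c\<^sub>0}. card {\<tau>\<in>E. \<tau> i = s \<and> \<tau> (a c) \<le> s \<and> \<tau> (b c) \<le> s})"
      using finEs by (simp add: sum_of_bool_eq Int_def Es_def conj_assoc)
    finally have "M ^ 3 * (\<Sum>\<tau>\<in>Es. N \<tau>)
        \<le> M ^ 3 * (card Es + (\<Sum>c\<in>A - {c\<^sub>0}. card {\<tau>\<in>E. \<tau> i = s \<and> \<tau> (a c) \<le> s \<and> \<tau> (b c) \<le> s}))"
      by simp
    also have "\<dots> = M\<^sup>2 * (M * card Es) +
        (\<Sum>c\<in>A - {c\<^sub>0}. M ^ 3 * card {\<tau>\<in>E. \<tau> i = s \<and> \<tau> (a c) \<le> s \<and> \<tau> (b c) \<le> s})"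
      by (simp add: sum_distrib_left algebra_simps power3_eq_cube power2_eq_square)
    also have "\<dots> = M\<^sup>2 * M ^ card I + (\<Sum>c\<in>A - {c\<^sub>0}. s\<^sup>2 * M ^ card I)"
      unfolding cardEs E_def
      by (intro arg_cong2[of _ _ _ _ "(+)"] sum.cong refl card_labellings_fixed_le_le)
        (use I ab s in auto)
    also have "\<dots> \<le> M\<^sup>2 * M ^ card I + d * (s\<^sup>2 * M ^ card I)"
      using A card_mono[OF A(1), of "A - {c\<^sub>0}"] by auto
    finally have "real (M ^ 3 * (\<Sum>\<tau>\<in>Es. N \<tau>)) \<le> real (M\<^sup>2 * M ^ card I + d * (s\<^sup>2 * M ^ card I))"
      by (simp only: of_nat_le_iff)
    moreover have "real (M\<^sup>2 * M ^ card I + d * (s\<^sup>2 * M ^ card I)) = real M ^ 2 * (real M ^ card I * q)"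
      using M by (simp add: q_def field_simps)
    ultimately have sumN: "M * (\<Sum>\<tau>\<in>Es. real (N \<tau>)) \<le> real M ^ card I * q"
      using M by (simp add: power3_eq_cube power2_eq_square)
    \<comment> \<open>The tangent of \<open>ln\<close> at \<open>q\<close> replaces Jensen's
      inequality: as the mean of \<open>N\<close> is at most \<open>q\<close>, the linear terms have
      a nonpositive sum.\<close>
    have "(\<Sum>\<tau>\<in>Es. ln (N \<tau>)) \<le> (\<Sum>\<tau>\<in>Es. ln q + (N \<tau> / q - 1))"
    proof (rule sum_mono)
      fix \<tau>
      have "ln (N \<tau> / q) \<le> N \<tau> / q - 1"
        using q N_pos[of \<tau>] by (intro ln_le_minus_one) simp
      then show "ln (N \<tau>) \<le> ln q + (N \<tau> / q - 1)"
        using q N_pos[of \<tau>] by (simp add: ln_div)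
    qed
    also have "\<dots> = card Es * ln q + ((\<Sum>\<tau>\<in>Es. real (N \<tau>)) / q - card Es)"
      by (simp add: sum.distrib sum_subtractf sum_divide_distrib)
    finally have "M * (\<Sum>\<tau>\<in>Es. ln (N \<tau>))
        \<le> M * (card Es * ln q + ((\<Sum>\<tau>\<in>Es. real (N \<tau>)) / q - card Es))"
      by (simp add: mult_left_mono)
    also have "\<dots> = (M * card Es) * ln q + (M * (\<Sum>\<tau>\<in>Es. real (N \<tau>)) / q - M * card Es)"
      by (simp add: algebra_simps)
    also have "\<dots> \<le> M ^ card I * ln q"
      using sumN q unfolding cardEs by (simp add: field_simps)
    finally show ?thesis by (simp add: Es_def q_def)
  qed
  have "(\<lambda>\<tau>. \<tau> i) ` E \<subseteq> {1..M}" using I by (auto simp: E_def)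
  then have "(\<Sum>\<tau>\<in>E. ln (N \<tau>)) = (\<Sum>s=1..M. \<Sum>\<tau>\<in>{\<tau>\<in>E. \<tau> i = s}. ln (N \<tau>))"
    using finE by (intro sum.group[symmetric]) auto
  then have "M * (\<Sum>\<tau>\<in>E. ln (N \<tau>)) = (\<Sum>s=1..M. M * (\<Sum>\<tau>\<in>{\<tau>\<in>E. \<tau> i = s}. ln (N \<tau>)))"
    by (simp add: sum_distrib_left)
  also have "\<dots> \<le> (\<Sum>s=1..M. M ^ card I * ln (1 + d * (s / M)\<^sup>2))"
    by (intro sum_mono main)
  finally show ?thesis by (simp add: E_def sum_distrib_left)
qed

section \<open>Transversals as functions\<close>

text \<open>Extensionality makes a map determined by its values on the rows, as the entropy bound
  requires, and keeps the set finite.\<close>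

definition transversal_maps :: "nat \<Rightarrow> (nat \<Rightarrow> nat \<Rightarrow> nat) \<Rightarrow> (nat \<Rightarrow> nat) set" where
  "transversal_maps n L =
     {f \<in> {..<n} \<rightarrow>\<^sub>E {..<n}. inj_on f {..<n} \<and> inj_on (\<lambda>r. L r (f r)) {..<n}}"

lemma finite_transversal_maps: "finite (transversal_maps n L)"
  by (simp add: transversal_maps_def finite_PiE)

text \<open>A set of \<open>n\<close> cells in distinct rows meets every row, so each transversal is
  the graph of such a map.\<close>

lemma card_transversals_le: "card {T. transversal n L T} \<le> card (transversal_maps n L)"
proof (rule surj_card_le[OF finite_transversal_maps])
  show "{T. transversal n L T} \<subseteq> (\<lambda>f. (\<lambda>r. (r, f r)) ` {..<n}) ` transversal_maps n L"
  proof
    fix T assume "T \<in> {T. transversal n L T}"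
    then have sub: "T \<subseteq> {..<n} \<times> {..<n}" and cT: "card T = n"
      and dist: "\<And>c d. c \<in> T \<Longrightarrow> d \<in> T \<Longrightarrow> c \<noteq> d \<Longrightarrow>
        fst c \<noteq> fst d \<and> snd c \<noteq> snd d \<and> L (fst c) (snd c) \<noteq> L (fst d) (snd d)"
      by (auto simp: transversal_def)
    have fst_inj: "inj_on fst T" using dist by (meson inj_onI)
    have "fst ` T = {..<n}"
      using sub cT card_image[OF fst_inj] by (intro card_subset_eq) auto
    then have ex: "\<exists>c. (r, c) \<in> T" if "r < n" for r
      using that by (metis imageE lessThan_iff prod.collapse)
    define f where "f = (\<lambda>r\<in>{..<n}. SOME c. (r, c) \<in> T)"
    have f: "(r, f r) \<in> T" if "r < n" for r
      using someI_ex[OF ex[OF that]] that by (simp add: f_def)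
    have "f \<in> transversal_maps n L"
      unfolding transversal_maps_def
    proof (intro CollectI conjI inj_onI)
      show "f \<in> {..<n} \<rightarrow>\<^sub>E {..<n}"
        using f sub by (force simp: f_def)
      fix x y assume xy: "x \<in> {..<n}" "y \<in> {..<n}"
      show "f x = f y \<Longrightarrow> x = y" "L x (f x) = L y (f y) \<Longrightarrow> x = y"
        using dist[of "(x, f x)" "(y, f y)"] f[of x] f[of y] xy by auto
    qed
    moreover have "(\<lambda>r. (r, f r)) ` {..<n} = T"
    proof (rule card_subset_eq)
      show "finite T" using sub by (rule finite_subset) simp
      show "card ((\<lambda>r. (r, f r)) ` {..<n}) = card T"
        using cT by (subst card_image) (auto simp: inj_on_def)
    qed (use f in auto)
    ultimately show "T \<in> (\<lambda>f. (\<lambda>r. (r, f r)) ` {..<n}) ` transversal_maps n L" by blast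
  qed
qed

lemma latin_square_row_inj:
  "latin_square n L \<Longrightarrow> i < n \<Longrightarrow> j < n \<Longrightarrow> j' < n \<Longrightarrow> L i j = L i j' \<Longrightarrow> j = j'"
  unfolding latin_square_def by metis

lemma latin_square_col_inj:
  "latin_square n L \<Longrightarrow> i < n \<Longrightarrow> i' < n \<Longrightarrow> j < n \<Longrightarrow> L i j = L i' j \<Longrightarrow> i = i'"
  unfolding latin_square_def by metis

lemma transversal_mapsD:
  assumes "latin_square n L" and "f \<in> transversal_maps n L"
  shows "bij_betw f {..<n} {..<n}" and "bij_betw (\<lambda>r. L r (f r)) {..<n} {..<n}"
proof -
  have "f ` {..<n} = {..<n}"
    using assms by (intro endo_inj_surj) (auto simp: transversal_maps_def)
  then show "bij_betw f {..<n} {..<n}"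
    using assms by (simp add: bij_betw_def transversal_maps_def)
  have "(\<lambda>r. L r (f r)) ` {..<n} = {..<n}"
    using assms by (intro endo_inj_surj) (auto simp: transversal_maps_def latin_square_def)
  then show "bij_betw (\<lambda>r. L r (f r)) {..<n} {..<n}"
    using assms by (simp add: bij_betw_def transversal_maps_def)
qed

text \<open>\<open>A r\<close> holds the columns usable in row \<open>r\<close>. The entropy bound
  is summed over all labellings, and for each map and row the sum over labellings is then estimated
  separately.\<close>

lemma ln_card_transversal_maps_le:
  fixes M d :: nat
  assumes L: "latin_square n L" and F: "F \<subseteq> transversal_maps n L" "F \<noteq> {}" and M: "0 < M"
    and A: "\<And>f r. f \<in> F \<Longrightarrow> r < n \<Longrightarrow> f r \<in> A r"
    and A_sub: "\<And>r. r < n \<Longrightarrow> A r \<subseteq> {..<n}" and A_card: "\<And>r. r < n \<Longrightarrow> card (A r) \<le> d"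
  shows "M * ln (card F) \<le> n * (\<Sum>s=1..M. ln (1 + d * (real s / M)\<^sup>2))"
proof -
  define S where "S = (\<Sum>s=1..M. ln (1 + d * (real s / M)\<^sup>2))"
  define E where "E = {..<n} \<rightarrow>\<^sub>E {1..M}"
  have finF: "finite F" using F finite_transversal_maps finite_subset by blast
  have cardE: "card E = M ^ n" by (simp add: E_def card_PiE)
  have avg: "M * (\<Sum>\<tau>\<in>E. ln (card (choices {..<n} \<tau> F f i))) \<le> M ^ n * S"
    if f: "f \<in> F" and i: "i < n" for f i
  proof -
    have fT: "f \<in> transversal_maps n L" using f F by blast
    note bij = transversal_mapsD[OF L fT]
    \<comment> \<open>\<open>a c\<close> and \<open>b c\<close> are the rows in which
      \<open>f\<close> uses the column \<open>c\<close> and the symbol \<open>L i c\<close>;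
      revealing either one rules out a column \<open>c \<noteq> f i\<close> in row
      \<open>i\<close>.\<close>
    define a where "a c = inv_into {..<n} f c" for c
    define b where "b c = inv_into {..<n} (\<lambda>r. L r (f r)) (L i c)" for c
    have Ln: "L i c < n" if "c < n" for c using L i that by (simp add: latin_square_def)
    have a: "a c < n" "f (a c) = c" if "c < n" for c
      using bij(1) that f_inv_into_f[of c f "{..<n}"] inv_into_into[of c f "{..<n}"]
      by (auto simp: a_def bij_betw_def)
    have b: "b c < n" "L (b c) (f (b c)) = L i c" if "c < n" for c
      using bij(2) Ln[OF that] f_inv_into_f[of "L i c" "\<lambda>r. L r (f r)" "{..<n}"]
        inv_into_into[of "L i c" "\<lambda>r. L r (f r)" "{..<n}"]
      by (auto simp: b_def bij_betw_def)
    have fi: "f i < n" using A[OF f i] A_sub[OF i] by auto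
    have "M * (\<Sum>\<tau>\<in>E. ln (card (choices {..<n} \<tau> F f i))) \<le> M ^ card {..<n} * S"
      unfolding E_def S_def
    proof (rule sum_ln_labellings_le[where A = "A i" and a = a and b = b and c\<^sub>0 = "f i"])
      show "finite (A i)" using A_sub[OF i] finite_subset by blast
      show "0 < card (choices {..<n} \<tau> F f i)" for \<tau>
        by (rule card_choices_pos[OF finF f])
      \<comment> \<open>Distinct rows have independent labels. If \<open>a c = b c\<close>, then
        column \<open>c\<close> would contain \<open>L i c\<close> in the two rows \<open>i\<close>
        and \<open>a c\<close>.\<close>
      show "a c \<in> {..<n} \<and> b c \<in> {..<n} \<and> distinct [i, a c, b c]" if "c \<in> A i - {f i}" for c
      proof -
        have c: "c < n" "c \<noteq> f i" using that A_sub[OF i] by auto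
        have "a c \<noteq> i" using a(2)[OF c(1)] c(2) by auto
        moreover have "b c \<noteq> i"
          using b(2)[OF c(1)] c latin_square_row_inj[OF L i fi c(1)] by auto
        moreover have "a c \<noteq> b c"
          using a[OF c(1)] b(2)[OF c(1)] latin_square_col_inj[OF L a(1)[OF c(1)] i c(1)] \<open>a c \<noteq> i\<close>
          by auto
        ultimately show ?thesis using a(1) b(1) c(1) by auto
      qed
      fix \<tau> :: "nat \<Rightarrow> nat"
      \<comment> \<open>If one of these rows were revealed strictly before \<open>i\<close>, then
        \<open>g\<close> would agree with \<open>f\<close> there and repeat a column or a symbol in
        row \<open>i\<close>.\<close>
      have "\<tau> (a (g i)) \<le> \<tau> i \<and> \<tau> (b (g i)) \<le> \<tau> i"
        if g: "g \<in> F" and agree: "\<forall>y\<in>{..<n}. \<tau> i < \<tau> y \<longrightarrow> g y = f y" for g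
      proof -
        have gi: "g i < n" using A[OF g i] A_sub[OF i] by auto
        have inj: "inj_on g {..<n}" "inj_on (\<lambda>r. L r (g r)) {..<n}"
          using g F by (auto simp: transversal_maps_def)
        have "a (g i) = i" if "\<tau> i < \<tau> (a (g i))"
          using inj_onD[OF inj(1), of "a (g i)" i] agree that a[OF gi] i by auto
        moreover have "b (g i) = i" if "\<tau> i < \<tau> (b (g i))"
          using inj_onD[OF inj(2), of "b (g i)" i] agree that b[OF gi] i by auto
        ultimately show ?thesis by (metis not_less order.irrefl)
      qed
      then have "choices {..<n} \<tau> F f i
          \<subseteq> {f i} \<union> {c \<in> A i - {f i}. \<tau> (a c) \<le> \<tau> i \<and> \<tau> (b c) \<le> \<tau> i}"
        using A i by (auto simp: choices_def)
      then show "card (choices {..<n} \<tau> F f i)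
          \<le> card ({f i} \<union> {c \<in> A i - {f i}. \<tau> (a c) \<le> \<tau> i \<and> \<tau> (b c) \<le> \<tau> i})"
        using finite_subset[OF A_sub[OF i]] by (intro card_mono) auto
    qed (use i M A_card in auto)
    then show ?thesis by simp
  qed
  have ext: "F \<subseteq> extensional {..<n}"
    using F by (auto simp: transversal_maps_def PiE_def)
  have "(\<Sum>\<tau>\<in>E. card F * ln (card F))
      \<le> (\<Sum>\<tau>\<in>E. \<Sum>f\<in>F. \<Sum>i<n. ln (card (choices {..<n} \<tau> F f i)))"
    by (intro sum_mono card_mult_ln_card_le finF ext) simp
  also have "\<dots> = (\<Sum>f\<in>F. \<Sum>i<n. \<Sum>\<tau>\<in>E. ln (card (choices {..<n} \<tau> F f i)))"
    by (subst sum.swap, rule sum.cong[OF refl], rule sum.swap)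
  finally have "M * (M ^ n * (card F * ln (card F)))
      \<le> M * (\<Sum>f\<in>F. \<Sum>i<n. \<Sum>\<tau>\<in>E. ln (card (choices {..<n} \<tau> F f i)))"
    by (intro mult_left_mono) (simp_all add: cardE)
  also have "\<dots> = (\<Sum>f\<in>F. \<Sum>i<n. M * (\<Sum>\<tau>\<in>E. ln (card (choices {..<n} \<tau> F f i))))"
    by (simp add: sum_distrib_left)
  also have "\<dots> \<le> (\<Sum>f\<in>F. \<Sum>i<n. M ^ n * S)"
    by (intro sum_mono avg) auto
  also have "\<dots> = (M ^ n * card F) * (n * S)" by simp
  finally have "(M ^ n * card F) * (M * ln (card F)) \<le> (M ^ n * card F) * (n * S)"
    by (simp add: mult_ac)
  moreover have "0 < real (M ^ n * card F)" using M F finF by (simp add: card_gt_0_iff)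
  ultimately show ?thesis unfolding S_def by (simp only: mult_le_cancel_left_pos)
qed

section \<open>The shifted Cayley table\<close>

lemma latin_squareI:
  assumes "\<And>i j. i < n \<Longrightarrow> j < n \<Longrightarrow> L i j < n"
    and "\<And>i. i < n \<Longrightarrow> inj_on (L i) {..<n}"
    and "\<And>j. j < n \<Longrightarrow> inj_on (\<lambda>i. L i j) {..<n}"
  shows "latin_square n L"
proof -
  have unique: "\<exists>!j. j < n \<and> f j = s" if "inj_on f {..<n}" "\<And>j. j < n \<Longrightarrow> f j < n" "s < n"
    for f :: "nat \<Rightarrow> nat" and s
  proof -
    have "f ` {..<n} = {..<n}" using that by (intro endo_inj_surj) auto
    then have "s \<in> f ` {..<n}" using that by simp
    then show ?thesis using that(1) by (auto simp: inj_on_def)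
  qed
  show ?thesis
    unfolding latin_square_def
    using assms unique[of "L i" for i] unique[of "\<lambda>i. L i j" for j] by simp
qed

text \<open>The index \<open>r\<close> stands for \<open>(r mod 3, r div 3) \<in> \<int>/3 \<times> \<int>/m\<close>.\<close>

definition shifted_square :: "nat \<Rightarrow> nat \<Rightarrow> nat \<Rightarrow> nat" where
  "shifted_square m r c = (r + c) mod 3 +
     3 * ((r div 3 + c div 3 + of_bool (odd m \<and> 3 dvd r \<and> 3 dvd c)) mod m)"

lemma shifted_square_mod: "shifted_square m r c mod 3 = (r + c) mod 3"
  by (simp add: shifted_square_def)

lemma shifted_square_div: "shifted_square m r c div 3 =
    (r div 3 + c div 3 + of_bool (odd m \<and> 3 dvd r \<and> 3 dvd c)) mod m"
  by (simp add: shifted_square_def)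

lemma shifted_square_commute: "shifted_square m r c = shifted_square m c r"
  by (simp add: shifted_square_def add.commute conj_commute)

text \<open>Within a row, the symbol modulo 3 fixes the column modulo 3 and hence whether the shift
  applies, so the shift cancels. Columns follow by commutativity.\<close>

lemma latin_square_shifted_square:
  assumes "0 < m"
  shows "latin_square (3 * m) (shifted_square m)"
proof (rule latin_squareI)
  show "shifted_square m i j < 3 * m" for i j
  proof -
    have "shifted_square m i j div 3 < m"
      using assms by (simp add: shifted_square_div)
    then show ?thesis by presburger
  qed
  have inj: "j = j'"
    if j: "j < 3 * m" "j' < 3 * m" and eq: "shifted_square m i j = shifted_square m i j'" for i j j'
  proof -
    have "(i + j) mod 3 = (i + j') mod 3"
      using eq shifted_square_mod by metis
    then have m3: "j mod 3 = j' mod 3"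
      by (simp only: cong_add_lcancel_nat flip: cong_def)
    then have "3 dvd j \<longleftrightarrow> 3 dvd j'" by presburger
    then have "(j div 3 + (i div 3 + of_bool (odd m \<and> 3 dvd i \<and> 3 dvd j))) mod m =
        (j' div 3 + (i div 3 + of_bool (odd m \<and> 3 dvd i \<and> 3 dvd j))) mod m"
      using arg_cong[OF eq, of "\<lambda>x. x div 3"] by (simp add: shifted_square_div ac_simps)
    then have "[j div 3 = j' div 3] (mod m)"
      by (simp only: cong_add_rcancel_nat flip: cong_def)
    then have "j div 3 = j' div 3"
      using j by (simp add: cong_def less_mult_imp_div_less mult.commute)
    with m3 show ?thesis by (metis div_mult_mod_eq)
  qed
  then show "inj_on (shifted_square m i) {..<3 * m}" for i
    by (auto intro!: inj_onI)
  then show "inj_on (\<lambda>i. shifted_square m i j) {..<3 * m}" for j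
    by (subst shifted_square_commute)
qed

section \<open>Residue counts along a transversal\<close>

lemma sum_div_3: "2 * (\<Sum>r<3 * m. r div 3) = 3 * (m * (m - 1 :: nat))"
proof (induction m)
  case (Suc m)
  have "{..<3 * Suc m} = insert (3 * m + 2) (insert (3 * m + 1) (insert (3 * m) {..<3 * m}))"
    by auto
  then have "(\<Sum>r<3 * Suc m. r div 3) = (\<Sum>r<3 * m. r div 3) + 3 * m"
    by (simp, presburger)
  then show ?case using Suc by (cases m) (simp_all add: algebra_simps)
qed simp

lemma card_residue_class_3:
  assumes "k < 3"
  shows "card {r. r < 3 * m \<and> r mod 3 = k} = m"
proof -
  have "{r. r < 3 * m \<and> r mod 3 = k} = (\<lambda>q. 3 * q + k) ` {..<m}"
  proof (intro equalityI subsetI)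
    fix r assume "r \<in> {r. r < 3 * m \<and> r mod 3 = k}"
    then have "r = 3 * (r div 3) + k" "r div 3 < m" by auto
    then show "r \<in> (\<lambda>q. 3 * q + k) ` {..<m}" by blast
  qed (use assms in auto)
  then show ?thesis by (simp add: card_image inj_on_def)
qed

text \<open>The sum of symbol minus row minus column over a transversal, taken in the
  \<open>\<int>/m\<close>-coordinates, is the number of its cells in the shifted block.\<close>

lemma dvd_card_shifted_block:
  assumes m: "0 < m" and f: "f \<in> transversal_maps (3 * m) (shifted_square m)"
  shows "odd m \<and> m dvd card {r. r < 3 * m \<and> r mod 3 = 0 \<and> f r mod 3 = 0}"
proof -
  note bij = transversal_mapsD[OF latin_square_shifted_square[OF m] f]
  define S where "S = (\<Sum>r<3 * m. r div 3)"
  define x where "x = card {r. r < 3 * m \<and> r mod 3 = 0 \<and> f r mod 3 = 0}"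
  define e where "e r = (of_bool (odd m \<and> 3 dvd r \<and> 3 dvd f r) :: nat)" for r
  have S_f: "(\<Sum>r<3 * m. f r div 3) = S"
    unfolding S_def by (rule sum.reindex_bij_betw[OF bij(1)])
  have "S = (\<Sum>r<3 * m. shifted_square m r (f r) div 3)"
    unfolding S_def by (rule sum.reindex_bij_betw[OF bij(2), symmetric])
  also have "\<dots> mod m = (\<Sum>r<3 * m. r div 3 + f r div 3 + e r) mod m"
    by (simp add: shifted_square_div e_def mod_sum_eq)
  \<comment> \<open>Modulo \<open>m\<close>, the symbols contribute one \<open>S\<close> on the
    left, the rows and the columns one \<open>S\<close> each on the right; cancelling leaves
    \<open>S\<close> plus the number of shifted cells.\<close>
  finally have "[0 + S = (S + (\<Sum>r<3 * m. e r)) + S] (mod m)"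
    unfolding cong_def sum.distrib S_f S_def[symmetric] by (simp add: ac_simps)
  then have dvd: "m dvd S + (\<Sum>r<3 * m. e r)"
    by (simp only: cong_add_rcancel_nat cong_0_iff cong_sym_eq[of 0])
  have S2: "2 * S = 3 * (m * (m - 1))" unfolding S_def by (rule sum_div_3)
  \<comment> \<open>For even \<open>m\<close> the shift is off, so \<open>m\<close> divides
    \<open>S\<close>, and the odd number \<open>3 * (m - 1)\<close> would be even.\<close>
  have odd: "odd m"
  proof
    assume even: "even m"
    then have "m dvd S" using dvd by (simp add: e_def)
    then obtain k where "S = m * k" by blast
    then have "m * (2 * k) = m * (3 * (m - 1))" using S2 by (simp add: ac_simps)
    then have "2 * k = 3 * (m - 1)" using m by simp
    then show False using even m by presburger
  qed
  then have "S = m * (3 * ((m - 1) div 2))" using S2 by (auto elim!: oddE)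
  then have "m dvd S" by simp
  then have "m dvd (\<Sum>r<3 * m. e r)" using dvd by (simp add: dvd_add_right_iff)
  moreover have "(\<Sum>r<3 * m. e r) = x"
    using odd by (simp add: e_def x_def sum_of_bool_eq Int_def dvd_eq_mod_eq_0)
  ultimately show ?thesis using odd by (simp add: x_def)
qed

text \<open>By divisibility, block \<open>(0, 0)\<close> holds 0 or \<open>m\<close> cells. Each
  class modulo 3 of rows, of columns and of symbols holds exactly \<open>m\<close> cells, and these
  linear equations then empty either the diagonal blocks or all the others.\<close>

lemma transversal_maps_shifted_square_cases:
  assumes m: "0 < m" and f: "f \<in> transversal_maps (3 * m) (shifted_square m)"
  shows "(\<forall>r<3 * m. f r mod 3 \<noteq> r mod 3) \<or> (\<forall>r<3 * m. f r mod 3 = r mod 3)"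
proof -
  note bij = transversal_mapsD[OF latin_square_shifted_square[OF m] f]
  define B where "B i j = {r. r < 3 * m \<and> r mod 3 = i \<and> f r mod 3 = j}" for i j
  define t where "t i j = card (B i j)" for i j
  have fin: "finite (B i j)" for i j by (simp add: B_def)
  have split3: "card (X \<union> Y \<union> Z) = card X + card Y + card Z"
    if "finite X" "finite Y" "finite Z" "X \<inter> Y = {}" "X \<inter> Z = {}" "Y \<inter> Z = {}" for X Y Z :: "nat set"
    using that by (simp add: card_Un_disjoint Int_Un_distrib2)
  have split_B: "card (B i j \<union> B i' j' \<union> B i'' j'') = t i j + t i' j' + t i'' j''"
    if "(i, j) \<noteq> (i', j')" "(i, j) \<noteq> (i'', j'')" "(i', j') \<noteq> (i'', j'')" for i j i' j' i'' j''
    unfolding t_def using that by (intro split3 fin) (auto simp: B_def)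
  have pre: "card {r. r < 3 * m \<and> g r mod 3 = k} = m"
    if g: "bij_betw g {..<3 * m} {..<3 * m}" and k: "k < 3" for g k
  proof -
    have "bij_betw g {r. r < 3 * m \<and> g r mod 3 = k} {r. r < 3 * m \<and> r mod 3 = k}"
      unfolding bij_betw_def
    proof (intro conjI equalityI subsetI)
      fix y assume y: "y \<in> {r. r < 3 * m \<and> r mod 3 = k}"
      then obtain r where "r < 3 * m" "y = g r" using g unfolding bij_betw_def by blast
      then show "y \<in> g ` {r. r < 3 * m \<and> g r mod 3 = k}" using y by auto
    qed (use g in \<open>auto simp: bij_betw_def inj_on_def\<close>)
    then show ?thesis using card_residue_class_3[OF k] by (simp add: bij_betw_same_card)
  qed
  have row: "t i 0 + t i 1 + t i 2 = m" if "i < 3" for i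
  proof -
    have "{r. r < 3 * m \<and> r mod 3 = i} = B i 0 \<union> B i 1 \<union> B i 2" by (auto simp: B_def)
    then show ?thesis
      using card_residue_class_3[OF that, of m] by (simp add: split_B)
  qed
  have col: "t 0 j + t 1 j + t 2 j = m" if "j < 3" for j
  proof -
    have "{r. r < 3 * m \<and> f r mod 3 = j} = B 0 j \<union> B 1 j \<union> B 2 j" by (auto simp: B_def)
    then show ?thesis
      using pre[OF bij(1) that] by (simp add: split_B)
  qed
  have sym: "card {r. r < 3 * m \<and> (r mod 3 + f r mod 3) mod 3 = k} = m" if "k < 3" for k
    using pre[OF bij(2) that] by (simp add: shifted_square_mod mod_add_eq)
  \<comment> \<open>These are the residue pairs with sum 0 modulo 3.\<close>
  have sym0: "t 0 0 + t 1 2 + t 2 1 = m"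
  proof -
    have "{r. r < 3 * m \<and> (r mod 3 + f r mod 3) mod 3 = 0} = B 0 0 \<union> B 1 2 \<union> B 2 1"
      unfolding B_def by (intro set_eqI, simp, presburger)
    then show ?thesis
      using sym[of 0] by (simp add: split_B)
  qed
  have empty: "\<not> (r < 3 * m \<and> r mod 3 = i \<and> f r mod 3 = j)" if "t i j = 0" for r i j
    using that fin[of i j] by (auto simp: t_def B_def)
  have mod3: "x mod 3 = 0 \<or> x mod 3 = 1 \<or> x mod 3 = 2" for x :: nat by presburger
  have "m dvd t 0 0"
    using dvd_card_shifted_block[OF assms] by (simp add: t_def B_def)
  moreover have "t 0 0 \<le> m" using row[of 0] by simp
  ultimately have "t 0 0 = 0 \<or> t 0 0 = m"
    by (metis dvd_imp_le le_antisym neq0_conv)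
  then show ?thesis
  proof
    assume t00: "t 0 0 = 0"
    \<comment> \<open>Row classes 1 and 2 hold \<open>2 * m\<close> cells. Column class 0 takes
      \<open>m\<close> of them and the blocks \<open>(1, 2)\<close>, \<open>(2, 1)\<close> another
      \<open>m\<close>, leaving none for \<open>(1, 1)\<close> and \<open>(2, 2)\<close>.\<close>
    then have "t 1 1 = 0" "t 2 2 = 0"
      using row[of 0] row[of 1] row[of 2] col[of 0] sym0 by simp_all
    then have "f r mod 3 \<noteq> r mod 3" if "r < 3 * m" for r
      using empty[of 0 0 r] empty[of 1 1 r] empty[of 2 2 r] t00 that mod3[of r] by auto
    then show ?thesis by blast
  next
    assume "t 0 0 = m"
    then have z: "t 0 1 = 0" "t 0 2 = 0" "t 1 0 = 0" "t 2 0 = 0" "t 1 2 = 0" "t 2 1 = 0"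
      using row[of 0] col[of 0] sym0 by simp_all
    have "f r mod 3 = r mod 3" if "r < 3 * m" for r
      using z[THEN empty, of r] that mod3[of r] mod3[of "f r"] by argo
    then show ?thesis by blast
  qed
qed

section \<open>Numerical estimates\<close>

text \<open>The Taylor polynomial of degree 4 gives \<open>65 / 24\<close>, and the crude bound
  \<open>exp 1 \<le> 3\<close> keeps the remainder below \<open>3 / 120\<close>.\<close>

lemma exp_1_le_11_4: "exp (1 :: real) \<le> 11 / 4"
proof -
  obtain t :: real where t: "\<bar>t\<bar> \<le> 1" "exp 1 = (\<Sum>k<5. 1 ^ k / fact k) + exp t / fact 5 * 1 ^ 5"
    using Maclaurin_exp_le[of 1 5] by auto
  have "exp t \<le> exp 1" using t(1) by simp
  also have "\<dots> \<le> 3" by (rule exp_le)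
  finally show ?thesis unfolding t(2) by (simp add: eval_nat_numeral)
qed

text \<open>The factor 2 pays for two families of transversals, and \<open>2 * n / 3\<close> is the
  number of usable columns. After \<open>ln n\<close> is taken out of each term, the mean of the 24
  logarithms tends to about -2.196, below -2.117.\<close>

lemma eventually_two_mult_exp_sum_ln_le:
  "\<forall>\<^sub>F n in sequentially.
     2 * exp (n / 24 * (\<Sum>s=1..24. ln (1 + 2 * real n / 3 * (real s / 24)\<^sup>2)))
       \<le> (real n / exp 2.117) ^ n"
proof -
  define u where "u s = 2 / 3 * (real s / 24)\<^sup>2" for s :: nat
  define R where "R n = (\<Prod>s=1..24. 1 / real n + u s)" for n :: nat
  have "R \<longlonglongrightarrow> (\<Prod>s=1..24. 0 + u s)"
    unfolding R_def by (intro tendsto_prod tendsto_add tendsto_const lim_1_over_n)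
  \<comment> \<open>The halving provides a slack of \<open>n / 24 * ln 2\<close> in the exponent,
    which later absorbs the factor 2.\<close>
  moreover have "(\<Prod>s=1..24. 0 + u s) < exp (- (24 * 2.117)) / 2"
  proof -
    \<comment> \<open>The exponent 50.808 is rounded up to 51 to reach an integer power of
      \<open>exp 1\<close>.\<close>
    have "exp (24 * 2.117) \<le> exp (real 51 * 1)" by simp
    also have "\<dots> = exp 1 ^ 51" by (rule exp_of_nat_mult)
    also have "\<dots> \<le> (11 / 4) ^ 51" by (intro power_mono exp_1_le_11_4) simp
    finally have e: "exp (24 * 2.117) \<le> (11 / 4 :: real) ^ 51" .
    have "(\<Prod>s=1..24. 0 + u s) < 1 / (2 * (11 / 4) ^ 51)"
      by (simp add: u_def numeral_eq_Suc)
    also have "\<dots> \<le> 1 / (2 * exp (24 * 2.117))"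
      using e by (intro divide_left_mono mult_left_mono) auto
    finally show ?thesis by (simp add: exp_minus field_simps)
  qed
  ultimately have "\<forall>\<^sub>F n in sequentially. R n < exp (- (24 * 2.117)) / 2"
    by (rule order_tendstoD)
  then show ?thesis
    using eventually_ge_at_top[of 24]
  proof eventually_elim
    case (elim n)
    have n: "0 < real n" using elim by simp
    have u: "0 < u s" if "s \<in> {1..24}" for s using that by (simp add: u_def)
    have pos: "0 < 1 / real n + u s" if "s \<in> {1..24}" for s
      using u[OF that] n by (simp add: add_pos_pos)
    have R: "0 < R n" unfolding R_def by (intro prod_pos ballI pos) auto
    have "(\<Sum>s=1..24. ln (1 + 2 * real n / 3 * (real s / 24)\<^sup>2)) = (\<Sum>s=1..24. ln n + ln (1 / n + u s))"
    proof (rule sum.cong[OF refl])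
      fix s :: nat assume s: "s \<in> {1..24}"
      have "1 + 2 * real n / 3 * (real s / 24)\<^sup>2 = n * (1 / n + u s)"
        using n by (simp add: u_def field_simps)
      then show "ln (1 + 2 * real n / 3 * (real s / 24)\<^sup>2) = ln n + ln (1 / n + u s)"
        using n pos[OF s] by (simp add: ln_mult)
    qed
    also have "\<dots> = 24 * ln n + ln (R n)"
    proof -
      have "ln (R n) = (\<Sum>s=1..24. ln (1 / n + u s))"
        unfolding R_def by (rule ln_prod) (metis finite_atLeastAtMost, metis pos less_irrefl)
      then show ?thesis by (simp add: sum.distrib)
    qed
    also have "ln (R n) \<le> - (24 * 2.117) - ln 2"
    proof -
      have "ln (R n) \<le> ln (exp (- (24 * 2.117)) / 2)"
        using R elim(1) by (subst ln_le_cancel_iff) auto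
      then show ?thesis by (simp add: ln_div)
    qed
    finally have "n / 24 * (\<Sum>s=1..24. ln (1 + 2 * real n / 3 * (real s / 24)\<^sup>2))
        \<le> n / 24 * (24 * ln n + (- (24 * 2.117) - ln 2))"
      by (intro mult_left_mono) auto
    also have "\<dots> = n * (ln n - 2.117) - n / 24 * ln 2"
      by (simp add: algebra_simps)
    \<comment> \<open>Since \<open>n\<close> is at least 24, the slack is at least
      \<open>ln 2\<close>.\<close>
    also have "\<dots> \<le> n * (ln n - 2.117) - ln 2"
      using elim(2) by (simp add: mult_right_le_one_le)
    finally have "exp (n / 24 * (\<Sum>s=1..24. ln (1 + 2 * real n / 3 * (real s / 24)\<^sup>2)))
        \<le> exp (n * (ln n - 2.117) - ln 2)"
      by (simp only: exp_le_cancel_iff)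
    also have "\<dots> = exp (n * (ln n - 2.117)) / 2"
      by (simp only: exp_diff exp_ln zero_less_numeral)
    also have "exp (n * (ln n - 2.117)) = (real n / exp 2.117) ^ n"
      using n by (simp add: exp_of_nat_mult exp_diff)
    finally show ?case by simp
  qed
qed

section \<open>Adding up the two families of transversals\<close>

theorem theorem1p1:
  shows "\<exists>N::nat. \<forall>n\<ge>N. n mod 3 = 0 \<longrightarrow>
    (\<exists>L. latin_square n L \<and>
       real (card {T. transversal n L T}) \<le> (real n / exp (2.117::real)) ^ n)"
proof -
  obtain N where N: "\<And>n. N \<le> n \<Longrightarrow>
      2 * exp (n / 24 * (\<Sum>s=1..24. ln (1 + 2 * real n / 3 * (real s / 24)\<^sup>2)))
        \<le> (real n / exp 2.117) ^ n"
    using eventually_two_mult_exp_sum_ln_le unfolding eventually_sequentially by blast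
  have "\<exists>L. latin_square n L \<and> real (card {T. transversal n L T}) \<le> (real n / exp 2.117) ^ n"
    \<comment> \<open>The bound 1 excludes \<open>n = 0\<close>, so that \<open>m\<close> is
      positive.\<close>
    if n: "max N 1 \<le> n" "n mod 3 = 0" for n
  proof -
    obtain m where m: "n = 3 * m" using n(2) by auto
    with n(1) have "0 < m" by simp
    define L where "L = shifted_square m"
    have L: "latin_square n L"
      unfolding L_def m using \<open>0 < m\<close> by (rule latin_square_shifted_square)
    define X where "X = exp (n / 24 * (\<Sum>s=1..24. ln (1 + 2 * real n / 3 * (real s / 24)\<^sup>2)))"
    have bound: "card F \<le> X"
      if F: "F \<subseteq> transversal_maps n L" and A: "\<And>f r. f \<in> F \<Longrightarrow> r < n \<Longrightarrow> f r \<in> A r"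
        and A_sub: "\<And>r. r < n \<Longrightarrow> A r \<subseteq> {..<n}" and A_card: "\<And>r. r < n \<Longrightarrow> card (A r) \<le> 2 * m"
      for F A
    proof (cases "F = {}")
      case False
      have "24 * ln (card F) \<le> n * (\<Sum>s=1..24. ln (1 + 2 * real n / 3 * (real s / 24)\<^sup>2))"
        using ln_card_transversal_maps_le[OF L F False, of 24 A "2 * m"] A A_sub A_card by (simp add: m)
      moreover have "0 < card F"
        using False F finite_transversal_maps finite_subset by (metis card_gt_0_iff)
      ultimately show ?thesis
        unfolding X_def by (subst ln_le_cancel_iff[symmetric]) simp_all
    qed (simp add: X_def)
    have card_eq: "card {c. c < n \<and> c mod 3 = r mod 3} = m" for r :: nat
      unfolding m by (rule card_residue_class_3) simp
    define F where "F = {f \<in> transversal_maps n L. \<forall>r<n. f r mod 3 \<noteq> r mod 3}"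
    define G where "G = {f \<in> transversal_maps n L. \<forall>r<n. f r mod 3 = r mod 3}"
    have range: "f r < n" if "f \<in> transversal_maps n L" "r < n" for f r
      using that by (auto simp: transversal_maps_def)
    have "card F \<le> X"
    proof (rule bound[where A = "\<lambda>r. {..<n} - {c. c < n \<and> c mod 3 = r mod 3}"])
      show "card ({..<n} - {c. c < n \<and> c mod 3 = r mod 3}) \<le> 2 * m" for r
        using card_eq[of r] by (subst card_Diff_subset) (auto simp: m)
    qed (auto simp: F_def range)
    \<comment> \<open>Each row now has only \<open>m\<close> usable columns, well within the common
      bound \<open>2 * m\<close>.\<close>
    moreover have "card G \<le> X"
      by (rule bound[where A = "\<lambda>r. {c. c < n \<and> c mod 3 = r mod 3}"])
        (auto simp: G_def range card_eq)
    moreover have "transversal_maps n L = F \<union> G"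
      using transversal_maps_shifted_square_cases[OF \<open>0 < m\<close>] by (auto simp: F_def G_def L_def m)
    then have "card {T. transversal n L T} \<le> card F + card G"
      using card_transversals_le[of n L] card_Un_le[of F G] by simp
    ultimately have "card {T. transversal n L T} \<le> 2 * X" by linarith
    also have "\<dots> \<le> (real n / exp 2.117) ^ n"
      unfolding X_def using n(1) by (intro N) simp
    finally show ?thesis using L by blast
  qed
  then show ?thesis by blast
qed

end
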